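(* Let $P$ be a $2$-dimensional reflexive polytope with $\delta$-vector $(1,\delta_1,1)$. Then either (i) the roots of $L_P$ are $\{-1/2\pm bi\}$ for some $b\in\mathbb{R}$, i.e. $P$ is a CL-polytope, or (ii) the roots of $L_P$ are $\{a,-1-a\}$ for some $a\in\mathbb{R}$, i.e. $P$ is real. Furthermore, the following four conditions are equivalent: (ia) $P$ is a CL-polytope; (ib) $\delta_1\leq 6$; (ic) $\operatorname{vol}(P)\leq 4$; (id) $|P\cap\mathbb{Z}^2|\leq 9$. Likewise, the following four conditions are equivalent: (iia) $P$ is real; (iib) $\delta_1\geq 6$; (iic) $\operatorname{vol}(P)\geq 4$; (iid) $|P\cap\mathbb{Z}^2|\geq 9$. In addition, in case (ii) one has $-1<a<0$, so that every root $z$ of $L_P$ satisfies $-1<\operatorname{Re}(z)<0$.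
   Context: A $d$-dimensional lattice polytope is a full-dimensional convex polytope $P\subset\mathbb{Z}^d\otimes_{\mathbb{Z}}\mathbb{Q}$ with vertices in $\mathbb{Z}^d$. It is reflexive if its dual $P^*:=\{u\in\mathbb{Z}^d\otimes_{\mathbb{Z}}\mathbb{Q}\mid\langle u,v\rangle\geq -1\text{ for all }v\in P\}$ is also a lattice polytope. $\operatorname{vol}(P)$ denotes the usual (non-normalised) Euclidean volume. The Ehrhart polynomial $L_P$ is the degree-$d$ polynomial with $L_P(m)=|mP\cap\mathbb{Z}^d|$ for all integers $m\geq 0$, regarded as a polynomial over $\mathbb{C}$. The $\delta$-vector $(\delta_0,\ldots,\delta_d)$ of $P$ is defined by $\sum_{m\geq 0}L_P(m)t^m=\frac{\delta_0+\delta_1t+\cdots+\delta_dt^d}{(1-t)^{d+1}}$; for reflexive $P$ it is palindromic with $\delta_0=1$. $P$ is a CL-polytope if every root $z\in\mathbb{C}$ of $L_P$ satisfies $\operatorname{Re}(z)=-1/2$, and $P$ is real if every root satisfies $\operatorname{Im}(z)=0$. *)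

theory Defs
  imports "HOL-Analysis.Analysis" "HOL-Computational_Algebra.Computational_Algebra"
begin

text \<open>
  Polytopes live in \<open>real ^ 'n\<close>, the real span of the lattice, rather than in its rational span.
  For polytopes with vertices in the lattice the two settings are interchangeable: taking real
  convex hulls is a bijection compatible with duals, dilations and lattice points, and Euclidean
  volume refers to the real polytope anyway.
\<close>

definition integer_lattice :: "(real ^ 'n) set" where
  "integer_lattice = {x. \<forall>i. x $ i \<in> \<int>}"

definition lattice_polytope :: "(real ^ 'n) set \<Rightarrow> bool" where
  "lattice_polytope P \<longleftrightarrow>
     polytope P \<and> aff_dim P = int CARD('n) \<and> (\<forall>v. v extreme_point_of P \<longrightarrow> v \<in> integer_lattice)"

definition dual_polytope :: "(real ^ 'n) set \<Rightarrow> (real ^ 'n) set" where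
  "dual_polytope P = {u. \<forall>v\<in>P. u \<bullet> v \<ge> -1}"

text \<open>
  The dual is bounded only if the origin is an interior point of the polytope, so that
  interiority of the origin need not be required separately.
\<close>

definition reflexive_polytope :: "(real ^ 'n) set \<Rightarrow> bool" where
  "reflexive_polytope P \<longleftrightarrow> lattice_polytope P \<and> lattice_polytope (dual_polytope P)"

definition ehrhart_poly :: "(real ^ 'n) set \<Rightarrow> complex poly" where
  "ehrhart_poly P = (THE L. degree L = CARD('n) \<and>
     (\<forall>m::nat. poly L (of_nat m) = of_nat (card ((\<lambda>x. real m *\<^sub>R x) ` P \<inter> integer_lattice))))"

definition ehrhart_roots :: "(real ^ 'n) set \<Rightarrow> complex set" where
  "ehrhart_roots P = {z. poly (ehrhart_poly P) z = 0}"

text \<open>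
  The list \<open>[\<delta>\<^sub>0, \<dots>, \<delta>\<^sub>d]\<close>. The quotient is taken in formal power series, where the
  denominator is a unit. Fixing the length makes the list unique, since \<open>Poly\<close> ignores
  trailing zeros.
\<close>

definition delta_vector :: "(real ^ 'n) set \<Rightarrow> int list" where
  "delta_vector P = (THE ds. length ds = CARD('n) + 1 \<and>
     Abs_fps (\<lambda>m. poly (ehrhart_poly P) (of_nat m)) =
       fps_of_poly (Poly (map of_int ds)) / (1 - fps_X) ^ (CARD('n) + 1))"

definition CL_polytope :: "(real ^ 'n) set \<Rightarrow> bool" where
  "CL_polytope P \<longleftrightarrow> lattice_polytope P \<and> (\<forall>z\<in>ehrhart_roots P. Re z = - 1 / 2)"

definition real_polytope :: "(real ^ 'n) set \<Rightarrow> bool" where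
  "real_polytope P \<longleftrightarrow> lattice_polytope P \<and> (\<forall>z\<in>ehrhart_roots P. Im z = 0)"

end

theory Submission
  imports Defs
begin

text \<open>
  Let \<open>u\<close> range over the vertices of the dual. Then \<open>m P\<close> is given by the integral inequalities
  \<open>u \<bullet> x \<ge> - m\<close>, so the lattice points of \<open>m P\<close> are those of \<open>(m - 1) P\<close> together with those on
  the boundary of \<open>m P\<close>. The boundary of a polygon is the disjoint union of its vertices and of
  its open edges, and an open edge dilated by \<open>m\<close> has \<open>m g - 1\<close> lattice points for some \<open>g\<close>;
  summing over \<open>m\<close>, the lattice point count is a quadratic polynomial in \<open>m\<close> with constant
  term \<open>1\<close>. Covering \<open>m P\<close> by unit cubes identifies its leading coefficient with the volume \<open>V\<close>.
  As \<open>\<delta>\<^sub>2 = 1\<close>, the linear coefficient is \<open>V\<close> too, and everything is read off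
  from \<open>V z\<^sup>2 + V z + 1 = 0\<close>, that is \<open>(z + 1/2)\<^sup>2 = 1/4 - 1/V\<close>.
\<close>

subsection \<open>Dual and dilations of reflexive polytopes\<close>

text \<open>Otherwise some nonzero \<open>a\<close> is nonnegative on \<open>interior P\<close>,
  hence on its closure and on \<open>P\<close>. Then every nonnegative multiple of \<open>a\<close>
  lies in the dual, which is therefore unbounded.\<close>

lemma zero_in_interior_if_bounded_dual:
  fixes P :: "(real ^ 'n) set"
  assumes "convex P" "interior P \<noteq> {}" "bounded (dual_polytope P)"
  shows "0 \<in> interior P"
proof (rule ccontr)
  assume "0 \<notin> interior P"
  then obtain a where "a \<noteq> 0" and a: "\<And>x. x \<in> interior P \<Longrightarrow> 0 \<le> a \<bullet> x"
    using separating_hyperplane_set_0[of "interior P"] assms(1) by (auto simp: convex_interior)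
  have "closure (interior P) \<subseteq> {x. a \<bullet> x \<ge> 0}"
    using a by (intro closure_minimal closed_halfspace_ge) auto
  then have ge: "0 \<le> a \<bullet> x" if "x \<in> P" for x
    using that closure_subset[of P] convex_closure_interior[OF assms(1,2)] by auto
  obtain B where B: "\<And>x. x \<in> dual_polytope P \<Longrightarrow> norm x \<le> B"
    using assms(3) by (auto simp: bounded_iff)
  \<comment> \<open>The vector \<open>t *\<^sub>R a\<close> has norm
    \<open>\<bar>B\<bar> + 1\<close>, just beyond the bound.\<close>
  define t where "t = (\<bar>B\<bar> + 1) / norm a"
  have "t \<ge> 0" by (simp add: t_def)
  then have "-1 \<le> (t *\<^sub>R a) \<bullet> x" if "x \<in> P" for x
    using mult_nonneg_nonneg[OF _ ge[OF that], of t] by simp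
  then have "t *\<^sub>R a \<in> dual_polytope P"
    by (auto simp: dual_polytope_def)
  then show False
    using B[of "t *\<^sub>R a"] \<open>a \<noteq> 0\<close> by (simp add: t_def)
qed

text \<open>A point outside \<open>P\<close> is strictly separated from \<open>P\<close> by some
  level \<open>b\<close> of a functional \<open>a\<close>. Since \<open>0\<close> lies in
  \<open>P\<close>, this level is negative, and dividing \<open>a\<close> by \<open>-b\<close> gives
  a dual point whose inequality fails at the outside point.\<close>

lemma bidual_polytope:
  fixes P :: "(real ^ 'n) set"
  assumes "closed P" "convex P" "0 \<in> P"
  shows "dual_polytope (dual_polytope P) = P"
proof (intro subset_antisym subsetI)
  fix x assume "x \<in> P"
  then show "x \<in> dual_polytope (dual_polytope P)"
    by (auto simp: dual_polytope_def inner_commute)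
next
  fix z assume z: "z \<in> dual_polytope (dual_polytope P)"
  show "z \<in> P"
  proof (rule ccontr)
    assume "z \<notin> P"
    then obtain a b where az: "a \<bullet> z < b" and ab: "\<And>x. x \<in> P \<Longrightarrow> b < a \<bullet> x"
      using separating_hyperplane_closed_point[OF assms(2,1)] by blast
    have "b < 0" using ab[OF assms(3)] by simp
    then have "-1 \<le> (a \<bullet> x) / (-b)" if "x \<in> P" for x
      using ab[OF that] by (simp add: field_simps)
    then have "(1 / (-b)) *\<^sub>R a \<in> dual_polytope P"
      by (simp add: dual_polytope_def)
    moreover have "\<forall>v\<in>dual_polytope P. -1 \<le> z \<bullet> v"
      using z by (simp add: dual_polytope_def[of "dual_polytope P"])
    ultimately have "-1 \<le> z \<bullet> ((1 / (-b)) *\<^sub>R a)"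
      by blast
    then have "-1 \<le> (a \<bullet> z) / (-b)"
      by (simp add: inner_commute)
    with az \<open>b < 0\<close> show False
      by (simp add: field_simps)
  qed
qed

lemma finite_integer_lattice_bounded:
  fixes S :: "(real ^ 'n) set"
  assumes "bounded S"
  shows "finite (S \<inter> integer_lattice)"
proof -
  obtain B where B: "\<And>x. x \<in> S \<Longrightarrow> norm x \<le> B"
    using assms by (auto simp: bounded_iff)
  let ?K = "{k \<in> \<int>. -B \<le> k \<and> k \<le> B}"
  have "S \<inter> integer_lattice \<subseteq> vec_lambda ` (UNIV \<rightarrow>\<^sub>E ?K)"
  proof
    fix x assume x: "x \<in> S \<inter> integer_lattice"
    have "x $ i \<in> ?K" for i
      using x component_le_norm_cart[of x i] B[of x] by (auto simp: integer_lattice_def)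
    then show "x \<in> vec_lambda ` (UNIV \<rightarrow>\<^sub>E ?K)"
      by (intro image_eqI[of _ _ "vec_nth x"]) auto
  qed
  moreover have "finite (UNIV \<rightarrow>\<^sub>E ?K :: ('n \<Rightarrow> real) set)"
    by (intro finite_PiE) (auto simp: finite_int_segment)
  ultimately show ?thesis
    using finite_subset by blast
qed

lemma inner_integer_lattice:
  fixes x y :: "real ^ 'n"
  assumes "x \<in> integer_lattice" "y \<in> integer_lattice"
  shows "x \<bullet> y \<in> \<int>"
  using assms by (auto simp: integer_lattice_def inner_vec_def intro!: Ints_sum Ints_mult)

locale reflexive =
  fixes P :: "(real ^ 'n) set"
  assumes reflexive: "reflexive_polytope P"
begin

definition dual_vertices :: "(real ^ 'n) set" where
  "dual_vertices = {u. u extreme_point_of dual_polytope P}"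

lemma polytope: "polytope P"
  and aff_dim: "aff_dim P = int CARD('n)"
  and vertex_lattice: "v extreme_point_of P \<Longrightarrow> v \<in> integer_lattice"
  and polytope_dual: "polytope (dual_polytope P)"
  and dual_vertices_lattice: "dual_vertices \<subseteq> integer_lattice"
  using reflexive by (auto simp: reflexive_polytope_def lattice_polytope_def dual_vertices_def)

lemma compact: "compact P" and convex: "convex P" and closed: "closed P" and bounded: "bounded P"
  using polytope by (auto simp: polytope_imp_compact polytope_imp_convex polytope_imp_bounded
      compact_imp_closed)

lemma finite_dual_vertices: "finite dual_vertices"
  unfolding dual_vertices_def
  by (intro finite_polyhedron_extreme_points polytope_imp_polyhedron polytope_dual)

lemma rel_interior_eq: "rel_interior P = interior P"
  using aff_dim by (intro interior_rel_interior) simp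

lemma zero_in_interior: "0 \<in> interior P"
proof (rule zero_in_interior_if_bounded_dual[OF convex])
  have "P \<noteq> {}" using aff_dim by auto
  then show "interior P \<noteq> {}"
    using rel_interior_eq convex rel_interior_eq_empty by metis
  show "bounded (dual_polytope P)"
    by (rule polytope_imp_bounded[OF polytope_dual])
qed

text \<open>By the bidual, \<open>P\<close> is cut out by the inequalities of all dual points. The
  dual is the convex hull of its extreme points, and for fixed \<open>x\<close> the condition on
  \<open>u\<close> is a closed half-space, so the extreme points suffice.\<close>

lemma mem_iff: "x \<in> P \<longleftrightarrow> (\<forall>u\<in>dual_vertices. -1 \<le> u \<bullet> x)"
proof -
  have dual: "dual_polytope P = convex hull dual_vertices"
    unfolding dual_vertices_def
    by (intro Krein_Milman_Minkowski polytope_imp_compact polytope_imp_convex polytope_dual)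
  have "x \<in> P \<longleftrightarrow> x \<in> dual_polytope (dual_polytope P)"
    using bidual_polytope[OF closed convex] zero_in_interior interior_subset by blast
  also have "\<dots> \<longleftrightarrow> convex hull dual_vertices \<subseteq> {u. x \<bullet> u \<ge> -1}"
    unfolding dual by (auto simp: dual_polytope_def)
  also have "\<dots> \<longleftrightarrow> dual_vertices \<subseteq> {u. x \<bullet> u \<ge> -1}"
    using hull_subset[of dual_vertices convex] hull_minimal[of dual_vertices _ convex]
      convex_halfspace_ge by (metis order_trans)
  finally show ?thesis
    by (auto simp: inner_commute)
qed

text \<open>As there are finitely many dual vertices, the strict inequalities define an open subset
  of \<open>P\<close>. Conversely, the interior passes into the interior of each half-space.\<close>

lemma mem_interior_iff: "x \<in> interior P \<longleftrightarrow> (\<forall>u\<in>dual_vertices. -1 < u \<bullet> x)"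
proof (intro iffI ballI)
  fix u assume x: "x \<in> interior P" and u: "u \<in> dual_vertices"
  have "interior P \<subseteq> interior {x. u \<bullet> x \<ge> -1}"
    using u mem_iff by (intro interior_mono) auto
  then show "-1 < u \<bullet> x"
    \<comment> \<open>For \<open>u = 0\<close> there is no bounding hyperplane, but the inequality
      reads -1 < 0.\<close>
    using x by (cases "u = 0") auto
next
  assume x: "\<forall>u\<in>dual_vertices. -1 < u \<bullet> x"
  let ?S = "\<Inter>u\<in>dual_vertices. {x. u \<bullet> x > -1}"
  have "open ?S"
    using finite_dual_vertices by (intro open_INT) (auto simp: open_halfspace_gt)
  moreover have "?S \<subseteq> P" by (auto simp: mem_iff less_imp_le)
  ultimately show "x \<in> interior P"
    using x by (intro interiorI[of ?S]) auto
qed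

text \<open>For positive \<open>t\<close> this rescales \<open>mem_iff\<close>. For
  \<open>t = 0\<close> the inequalities describe the recession cone, which is trivial because
  \<open>P\<close> is bounded. That case serves the step from dilation 0 to dilation 1.\<close>

lemma mem_dilate_iff:
  assumes "t \<ge> 0"
  shows "x \<in> (\<lambda>x. t *\<^sub>R x) ` P \<longleftrightarrow> (\<forall>u\<in>dual_vertices. -t \<le> u \<bullet> x)"
proof (cases "t = 0")
  case False
  with assms have "t > 0" by simp
  then have "x \<in> (\<lambda>x. t *\<^sub>R x) ` P \<longleftrightarrow> x /\<^sub>R t \<in> P"
    by (auto intro!: image_eqI[of _ _ "x /\<^sub>R t"])
  also have "\<dots> \<longleftrightarrow> (\<forall>u\<in>dual_vertices. -t \<le> u \<bullet> x)"
    unfolding mem_iff using \<open>t > 0\<close> by (simp add: field_simps)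
  finally show ?thesis .
next
  case True
  have "x = 0" if x: "\<forall>u\<in>dual_vertices. 0 \<le> u \<bullet> x"
  proof (rule ccontr)
    assume "x \<noteq> 0"
    obtain B where B: "\<And>x. x \<in> P \<Longrightarrow> norm x \<le> B"
      using bounded by (auto simp: bounded_iff)
    define s where "s = (\<bar>B\<bar> + 1) / norm x"
    have "s \<ge> 0" by (simp add: s_def)
    then have "-1 \<le> u \<bullet> (s *\<^sub>R x)" if "u \<in> dual_vertices" for u
      using mult_nonneg_nonneg[of s "u \<bullet> x"] x that by (simp add: order_trans[of "-1" 0])
    then have "s *\<^sub>R x \<in> P" by (simp add: mem_iff)
    then show False
      using B[of "s *\<^sub>R x"] \<open>x \<noteq> 0\<close> by (simp add: s_def)
  qed
  moreover have "0 \<in> P" using zero_in_interior interior_subset by blast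
  ultimately show ?thesis
    using True by auto
qed

definition lattice_count :: "nat \<Rightarrow> nat" where
  "lattice_count m = card ((\<lambda>x. real m *\<^sub>R x) ` P \<inter> integer_lattice)"

text \<open>Points are scaled back to the frontier of the fixed \<open>P\<close>, so that one
  decomposition into vertices and edges serves every dilation factor.\<close>

definition boundary_lattice :: "nat \<Rightarrow> (real ^ 'n) set" where
  "boundary_lattice m = {x \<in> integer_lattice. x /\<^sub>R real m \<in> frontier P}"

lemma finite_dilate_lattice: "finite ((\<lambda>x. t *\<^sub>R x) ` P \<inter> integer_lattice)"
  by (intro finite_integer_lattice_bounded bounded_scaling bounded)

lemma lattice_count_0: "lattice_count 0 = 1"
proof -
  have "(\<lambda>x. real 0 *\<^sub>R x) ` P \<inter> integer_lattice = {0}"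
    using zero_in_interior interior_subset by (force simp: integer_lattice_def)
  then show ?thesis by (simp add: lattice_count_def)
qed

text \<open>Reflexivity enters here: the facets of \<open>P\<close> have lattice distance one from the origin, so no
  lattice point lies strictly between two consecutive dilates of the boundary.\<close>

lemma lattice_interior_dilate_iff:
  assumes "x \<in> integer_lattice"
  shows "x /\<^sub>R real (Suc m) \<in> interior P \<longleftrightarrow> x \<in> (\<lambda>x. real m *\<^sub>R x) ` P"
proof -
  have "-1 < u \<bullet> (x /\<^sub>R real (Suc m)) \<longleftrightarrow> - real m \<le> u \<bullet> x" if "u \<in> dual_vertices" for u
  proof -
    have "u \<bullet> x \<in> \<int>"
      using that assms dual_vertices_lattice by (auto intro: inner_integer_lattice)
    then obtain k where "u \<bullet> x = of_int k" by (auto elim: Ints_cases)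
    moreover have "-1 < u \<bullet> (x /\<^sub>R real (Suc m)) \<longleftrightarrow> of_int (- int (Suc m)) < u \<bullet> x"
      by (simp add: field_simps)
    moreover have "- real m = of_int (- int m)" by simp
    ultimately show ?thesis
      by (simp only: of_int_less_iff of_int_le_iff) linarith
  qed
  then show ?thesis
    by (simp add: mem_interior_iff mem_dilate_iff)
qed

text \<open>A lattice point of the larger dilate is on its boundary or in its interior, and by
  \<open>lattice_interior_dilate_iff\<close> the interior ones are exactly the lattice points of the
  previous dilate.\<close>

lemma lattice_dilate_Suc:
  "(\<lambda>x. real (Suc m) *\<^sub>R x) ` P \<inter> integer_lattice =
     ((\<lambda>x. real m *\<^sub>R x) ` P \<inter> integer_lattice) \<union> boundary_lattice (Suc m)"
  (is "?L = ?A \<union> ?B")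
  and disjoint_boundary_lattice:
  "((\<lambda>x. real m *\<^sub>R x) ` P \<inter> integer_lattice) \<inter> boundary_lattice (Suc m) = {}"
proof -
  have mem: "x \<in> (\<lambda>x. real (Suc m) *\<^sub>R x) ` P \<longleftrightarrow> x /\<^sub>R real (Suc m) \<in> P" for x
    by (auto intro!: image_eqI[of _ _ "x /\<^sub>R real (Suc m)"] simp del: of_nat_Suc)
  have front: "frontier P = P - interior P"
    using closed by (simp add: frontier_def)
  have "x \<in> ?L \<longleftrightarrow> x \<in> ?A \<union> ?B" for x
    using lattice_interior_dilate_iff[of x m] mem[of x] interior_subset[of P]
    by (auto simp: boundary_lattice_def front)
  then show "?L = ?A \<union> ?B" by blast
  show "?A \<inter> ?B = {}"
    using lattice_interior_dilate_iff by (auto simp: boundary_lattice_def front)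
qed

lemma lattice_count_Suc:
  "lattice_count (Suc m) = lattice_count m + card (boundary_lattice (Suc m))"
  and finite_boundary_lattice: "finite (boundary_lattice (Suc m))"
proof -
  show "finite (boundary_lattice (Suc m))"
    using finite_dilate_lattice[of "real (Suc m)"] unfolding lattice_dilate_Suc by simp
  then show "lattice_count (Suc m) = lattice_count m + card (boundary_lattice (Suc m))"
    unfolding lattice_count_def lattice_dilate_Suc
    by (intro card_Un_disjoint finite_dilate_lattice disjoint_boundary_lattice)
qed

end

subsection \<open>Lattice points on the boundary of a polygon\<close>

text \<open>A nonzero \<open>d j\<close> forces \<open>t\<close> to be rational. In lowest terms its
  denominator divides every \<open>d i\<close>, hence their gcd. This gives the spacing of the
  lattice points along a segment with direction \<open>d\<close>.\<close>

lemma mult_Ints_iff_mult_Gcd_Ints: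
  fixes t :: real and d :: "'a \<Rightarrow> int"
  assumes "d j \<noteq> 0"
  shows "(\<forall>i. t * of_int (d i) \<in> \<int>) \<longleftrightarrow> t * of_int (Gcd (range d)) \<in> \<int>"
proof
  assume t: "\<forall>i. t * of_int (d i) \<in> \<int>"
  then obtain k where "t * of_int (d j) = of_int k"
    by (meson Ints_cases)
  then have "t = of_int k / of_int (d j)"
    using assms by (simp add: field_simps)
  then have "t \<in> \<rat>" by simp
  then obtain p q where "q > 0" and coprime: "coprime p q" and t_eq: "t = of_int p / of_int q"
    by (rule Rats_cases')
  have "q dvd d i" for i
  proof -
    obtain k where "t * of_int (d i) = of_int k"
      using t by (meson Ints_cases)
    then have "real_of_int (p * d i) = of_int (k * q)"
      using \<open>q > 0\<close> by (simp add: t_eq field_simps)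
    then have "p * d i = k * q"
      by (simp only: of_int_eq_iff)
    then have "q dvd p * d i" by simp
    then show ?thesis
      using coprime by (simp add: coprime_dvd_mult_right_iff coprime_commute)
  qed
  then have "q dvd Gcd (range d)"
    by (auto intro: Gcd_greatest)
  then obtain e where "Gcd (range d) = q * e" ..
  then have "t * of_int (Gcd (range d)) = of_int (p * e)"
    using \<open>q > 0\<close> by (simp add: t_eq)
  then show "t * of_int (Gcd (range d)) \<in> \<int>" by (metis Ints_of_int)
next
  assume t: "t * of_int (Gcd (range d)) \<in> \<int>"
  show "\<forall>i. t * of_int (d i) \<in> \<int>"
  proof
    fix i
    have "Gcd (range d) dvd d i" by (simp add: Gcd_dvd)
    then obtain e where "d i = Gcd (range d) * e" ..
    then have "t * of_int (d i) = t * of_int (Gcd (range d)) * of_int e" by simp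
    then show "t * of_int (d i) \<in> \<int>"
      using t by (metis Ints_mult Ints_of_int)
  qed
qed

text \<open>Here \<open>g\<close> is the lattice length of the segment, the gcd of the coordinates
  of \<open>b - a\<close>. Starting at the lattice point \<open>m a\<close>, lattice points recur at
  steps of \<open>(b - a) / g\<close>, so the interior ones are numbered from 1 to
  \<open>m * g - 1\<close>.\<close>

lemma lattice_points_dilated_segment:
  fixes a b :: "real ^ 'n"
  assumes "a \<noteq> b" "a \<in> integer_lattice" "b \<in> integer_lattice"
  shows "\<exists>g>0. \<forall>m>0.
    card {x \<in> integer_lattice. x /\<^sub>R real m \<in> open_segment a b} = m * g - 1"
proof -
  have "(b - a) $ i \<in> \<int>" for i
    using assms by (auto simp: integer_lattice_def)
  then have "\<forall>i. \<exists>k. (b - a) $ i = of_int k"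
    by (meson Ints_cases)
  then obtain d where d: "\<And>i. (b - a) $ i = of_int (d i)" by metis
  obtain j where j: "d j \<noteq> 0"
    using assms(1) d by (metis eq_iff_diff_eq_0 of_int_0 vec_eq_iff zero_index)
  define g where "g = nat (Gcd (range d))"
  have "Gcd (range d) \<noteq> 0" using j by (auto simp: Gcd_0_iff)
  then have "Gcd (range d) > 0" by (metis Gcd_int_greater_eq_0 order_le_less)
  then have g: "g > 0" "of_int (Gcd (range d)) = real g" by (auto simp: g_def)
  have lattice: "t *\<^sub>R (b - a) \<in> integer_lattice \<longleftrightarrow> t * real g \<in> \<int>" for t
    using mult_Ints_iff_mult_Gcd_Ints[of d j t, OF j] d g by (simp add: integer_lattice_def)
  have card: "card {x \<in> integer_lattice. x /\<^sub>R real m \<in> open_segment a b} = m * g - 1"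
    if m: "m > 0" for m
  proof -
    define f where "f k = real m *\<^sub>R a + (real k / real g) *\<^sub>R (b - a)" for k
    have ma: "real m *\<^sub>R a \<in> integer_lattice"
      using assms by (auto simp: integer_lattice_def)
    have "inj f"
      using assms(1) g by (auto simp: inj_def f_def)
    have shift: "real m *\<^sub>R a + s *\<^sub>R (b - a) \<in> integer_lattice \<longleftrightarrow> s * real g \<in> \<int>" for s
    proof -
      have "real m *\<^sub>R a + s *\<^sub>R (b - a) \<in> integer_lattice
          \<longleftrightarrow> s *\<^sub>R (b - a) \<in> integer_lattice"
        using ma by (auto simp: integer_lattice_def)
      then show ?thesis by (simp add: lattice)
    qed
    have "{x \<in> integer_lattice. x /\<^sub>R real m \<in> open_segment a b} = f ` {0<..<m * g}"
    proof (intro subset_antisym subsetI)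
      fix x assume "x \<in> {x \<in> integer_lattice. x /\<^sub>R real m \<in> open_segment a b}"
      then obtain u where x: "x \<in> integer_lattice" and u: "0 < u" "u < 1"
        and "x /\<^sub>R real m = (1 - u) *\<^sub>R a + u *\<^sub>R b"
        by (auto simp: in_segment)
      then have "x /\<^sub>R real m = a + u *\<^sub>R (b - a)"
        by (simp add: algebra_simps)
      then have "real m *\<^sub>R (x /\<^sub>R real m) = real m *\<^sub>R (a + u *\<^sub>R (b - a))"
        by (rule arg_cong)
      then have x_eq: "x = real m *\<^sub>R a + (real m * u) *\<^sub>R (b - a)"
        using m by (simp add: algebra_simps)
      then obtain k where k: "real m * u * real g = of_int k"
        using x shift[of "real m * u"] by (auto elim: Ints_cases)
      have "0 < real m * u * real g" "real m * u * real g < real m * real g"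
        using u m g by auto
      then have "0 < k" and "real_of_int k < of_int (int (m * g))"
        unfolding k by auto
      then have "0 < nat k" "nat k < m * g" "of_int k = real (nat k)"
        by (simp_all only: of_int_less_iff nat_less_iff zero_less_nat_eq less_imp_le of_nat_nat)
      moreover have "real m * u = of_int k / real g"
        using k g by (simp add: field_simps)
      ultimately have "x = f (nat k)" "nat k \<in> {0<..<m * g}"
        using x_eq by (auto simp: f_def)
      then show "x \<in> f ` {0<..<m * g}" by blast
    next
      fix x assume "x \<in> f ` {0<..<m * g}"
      then obtain k where x: "x = f k" and k: "0 < k" "k < m * g" by auto
      define u where "u = real k / (real m * real g)"
      have "real k < real m * real g" using k by (metis of_nat_less_iff of_nat_mult)
      then have "0 < u" "u < 1" using k m g by (auto simp: u_def)
      moreover have "x /\<^sub>R real m = (1 - u) *\<^sub>R a + u *\<^sub>R b"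
      proof -
        have "u = (real k / real g) / real m" by (simp add: u_def)
        then have "x /\<^sub>R real m = a + u *\<^sub>R (b - a)"
          using m by (simp add: x f_def scaleR_add_right divide_inverse mult.commute)
        then show ?thesis by (simp add: algebra_simps)
      qed
      moreover have "x \<in> integer_lattice"
        unfolding x f_def shift using g by simp
      ultimately show "x \<in> {x \<in> integer_lattice. x /\<^sub>R real m \<in> open_segment a b}"
        using assms(1) by (auto simp: in_segment)
    qed
    then show ?thesis
      using \<open>inj f\<close> by (simp add: card_image inj_on_subset)
  qed
  from g(1) card show ?thesis by blast
qed

locale reflexive_polygon = reflexive P for P :: "(real ^ 2) set"
begin

text \<open>A facet of a polygon is compact, convex and one-dimensional, hence a segment. Its ends
  are extreme points of a face, so they are vertices of \<open>P\<close> and lie in the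
  lattice.\<close>

lemma facet_segment:
  assumes "F facet_of P"
  obtains a b where "a \<noteq> b" "a \<in> integer_lattice" "b \<in> integer_lattice" "F = closed_segment a b"
proof -
  have F: "F face_of P" "F \<noteq> {}" "aff_dim F = 1"
    using assms aff_dim by (auto simp: facet_of_def)
  have "polytope F" by (rule face_of_polytope_polytope[OF polytope F(1)])
  then have "compact F" "convex F" by (auto simp: polytope_imp_compact polytope_imp_convex)
  moreover have "collinear F" using F by (simp add: collinear_aff_dim)
  ultimately obtain a b where ab: "F = closed_segment a b"
    using compact_convex_collinear_segment F(2) by blast
  have "a \<noteq> b" using F(3) ab by auto
  have "a extreme_point_of F" "b extreme_point_of F"
    by (auto simp: ab extreme_point_of_segment)
  then have "a \<in> integer_lattice" "b \<in> integer_lattice"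
    using vertex_lattice by (simp_all add: extreme_point_of_face[OF F(1)])
  then show ?thesis
    using \<open>a \<noteq> b\<close> ab by (intro that)
qed

text \<open>Such a point lies strictly between the two ends of an edge. This separates vertices from
  open edges when boundary points are counted.\<close>

lemma rel_interior_facet_not_extreme:
  assumes "F facet_of P" "x \<in> rel_interior F"
  shows "\<not> x extreme_point_of P"
proof -
  obtain a b where ab: "a \<noteq> b" "F = closed_segment a b"
    using facet_segment[OF assms(1)] by metis
  then have "x \<in> open_segment a b"
    using assms(2) by (simp add: rel_interior_closed_segment)
  moreover have "a \<in> P" "b \<in> P"
    using facet_of_imp_subset[OF assms(1)] ab by auto
  ultimately show ?thesis
    by (auto simp: extreme_point_of_def)
qed

text \<open>The frontier is the union of the facets, and each facet is an open segment together with
  two endpoints that are vertices of \<open>P\<close>.\<close>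

lemma frontier_eq:
  "frontier P = {v. v extreme_point_of P} \<union> (\<Union>F\<in>{F. F facet_of P}. rel_interior F)"
proof -
  have eq: "frontier P = \<Union>{F. F facet_of P}"
    using rel_frontier_of_polyhedron[OF polytope_imp_polyhedron[OF polytope]] rel_interior_eq
    by (simp add: rel_frontier_def frontier_def)
  show ?thesis
  proof (intro subset_antisym subsetI)
    fix x assume "x \<in> frontier P"
    then obtain F where F: "F facet_of P" "x \<in> F" by (auto simp: eq)
    obtain a b where ab: "a \<noteq> b" "F = closed_segment a b"
      using facet_segment[OF F(1)] by metis
    show "x \<in> {v. v extreme_point_of P} \<union> (\<Union>F\<in>{F. F facet_of P}. rel_interior F)"
    proof (cases "x \<in> rel_interior F")
      case False
      then have "x extreme_point_of F"
        using F ab by (auto simp: rel_interior_closed_segment extreme_point_of_segment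
            open_segment_def)
      then show ?thesis
        by (simp add: extreme_point_of_face[OF facet_of_imp_face_of[OF F(1)]])
    qed (use F in auto)
  next
    fix x assume "x \<in> {v. v extreme_point_of P} \<union> (\<Union>F\<in>{F. F facet_of P}. rel_interior F)"
    then show "x \<in> frontier P"
    proof (elim UnE)
      assume "x \<in> {v. v extreme_point_of P}"
      then show ?thesis
        using extreme_point_not_in_interior[of x P] closed
        by (auto simp: frontier_def extreme_point_of_def)
    next
      assume "x \<in> (\<Union>F\<in>{F. F facet_of P}. rel_interior F)"
      then show ?thesis
        by (auto simp: eq intro: subsetD[OF rel_interior_subset])
    qed
  qed
qed

text \<open>At factor \<open>m\<close>, an edge of lattice length \<open>g\<close> contributes
  \<open>m * g - 1\<close> and each vertex contributes one point. So \<alpha> is the total lattice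
  length of the edges, and \<beta> is the number of vertices minus the number of edges.\<close>

lemma card_boundary_lattice:
  "\<exists>\<alpha> \<beta> :: real. \<forall>m. real (card (boundary_lattice (Suc m))) = \<alpha> * real (Suc m) + \<beta>"
proof -
  let ?V = "{v. v extreme_point_of P}" and ?F = "{F. F facet_of P}"
  let ?S = "\<lambda>m F. {x \<in> integer_lattice. x /\<^sub>R real (Suc m) \<in> rel_interior F}"
  let ?T = "\<lambda>m. {x \<in> integer_lattice. x /\<^sub>R real (Suc m) \<in> ?V}"
  have fin: "finite ?F" by (rule finite_polytope_facets[OF polytope])
  have seg: "\<exists>g>0. \<forall>m. card (?S m F) = Suc m * g - 1" if F: "F facet_of P" for F
  proof -
    obtain a b where ab: "a \<noteq> b" "a \<in> integer_lattice" "b \<in> integer_lattice"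
      "F = closed_segment a b"
      using facet_segment[OF F] .
    then obtain g where "g > 0" and
      g: "\<forall>m>0. card {x \<in> integer_lattice. x /\<^sub>R real m \<in> open_segment a b} = m * g - 1"
      using lattice_points_dilated_segment by blast
    have "rel_interior F = open_segment a b"
      using ab by (simp add: rel_interior_closed_segment)
    then have "card (?S m F) = Suc m * g - 1" for m
      using g[rule_format, of "Suc m"] by simp
    with \<open>g > 0\<close> show ?thesis by (intro exI[of _ g] conjI allI)
  qed
  \<comment> \<open>One length per facet is fixed for all \<open>m\<close> at once, which makes the
    slope \<alpha> independent of \<open>m\<close>.\<close>
  define g where "g F = (SOME g. g > 0 \<and> (\<forall>m. card (?S m F) = Suc m * g - 1))" for F :: "(real ^ 2) set"
  have "g F > 0 \<and> (\<forall>m. card (?S m F) = Suc m * g F - 1)" if "F facet_of P" for F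
    unfolding g_def by (rule someI_ex[OF seg[OF that]])
  then have g: "\<And>F. F facet_of P \<Longrightarrow> g F > 0"
    and card_S: "\<And>F m. F facet_of P \<Longrightarrow> card (?S m F) = Suc m * g F - 1"
    by simp_all
  have card: "real (card (boundary_lattice (Suc m)))
      = real (\<Sum>F\<in>?F. g F) * real (Suc m) + (real (card ?V) - real (card ?F))" for m
  proof -
    have split: "boundary_lattice (Suc m) = ?T m \<union> (\<Union>F\<in>?F. ?S m F)"
      unfolding boundary_lattice_def frontier_eq by auto
    then have fin': "finite (?T m)" "\<And>F. F \<in> ?F \<Longrightarrow> finite (?S m F)"
      using finite_boundary_lattice[of m] by (auto intro: rev_finite_subset)
    have "card (boundary_lattice (Suc m)) = card (?T m) + card (\<Union>F\<in>?F. ?S m F)"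
      unfolding split using fin fin' rel_interior_facet_not_extreme
      by (intro card_Un_disjoint) auto
    \<comment> \<open>Two faces whose relative interiors meet are equal, so the open edges are
      pairwise disjoint.\<close>
    also have "card (\<Union>F\<in>?F. ?S m F) = (\<Sum>F\<in>?F. card (?S m F))"
      using fin fin' face_of_eq[OF facet_of_imp_face_of facet_of_imp_face_of]
      by (intro card_UN_disjoint) blast+
    also have "card (?T m) = card ?V"
    proof -
      have "?T m = (\<lambda>v. real (Suc m) *\<^sub>R v) ` ?V"
      proof (intro subset_antisym subsetI)
        fix x assume "x \<in> ?T m"
        then show "x \<in> (\<lambda>v. real (Suc m) *\<^sub>R v) ` ?V"
          by (intro image_eqI[of _ _ "x /\<^sub>R real (Suc m)"]) (auto simp del: of_nat_Suc)
      next
        fix x assume "x \<in> (\<lambda>v. real (Suc m) *\<^sub>R v) ` ?V"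
        then obtain v where v: "x = real (Suc m) *\<^sub>R v" "v extreme_point_of P" by auto
        moreover have "x \<in> integer_lattice"
          using vertex_lattice[OF v(2)]
          unfolding v(1) by (auto simp: integer_lattice_def simp del: of_nat_Suc)
        ultimately show "x \<in> ?T m" by (auto simp del: of_nat_Suc)
      qed
      then show ?thesis
        by (simp add: card_image inj_on_def del: of_nat_Suc)
    qed
    finally have "real (card (boundary_lattice (Suc m)))
        = real (card ?V) + (\<Sum>F\<in>?F. real (Suc m * g F - 1))"
      using card_S by simp
    \<comment> \<open>Positivity of \<open>g F\<close> keeps the subtraction on naturals from
      truncating.\<close>
    also have "(\<Sum>F\<in>?F. real (Suc m * g F - 1)) = (\<Sum>F\<in>?F. real (g F) * real (Suc m) - 1)"
      using g by (intro sum.cong refl) (auto simp: of_nat_diff Suc_le_eq algebra_simps)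
    also have "\<dots> = real (\<Sum>F\<in>?F. g F) * real (Suc m) - real (card ?F)"
      by (simp add: sum_subtractf sum_distrib_right del: of_nat_Suc)
    finally show ?thesis by simp
  qed
  show ?thesis using card by blast
qed

lemma lattice_count_quadratic:
  "\<exists>A B :: real. \<forall>m. real (lattice_count m) = A * (real m)\<^sup>2 + B * real m + 1"
proof -
  obtain \<alpha> \<beta> where "\<And>m. real (card (boundary_lattice (Suc m))) = \<alpha> * real (Suc m) + \<beta>"
    using card_boundary_lattice by blast
  then have count_Suc: "real (lattice_count (Suc m)) = real (lattice_count m) + (\<alpha> * (real m + 1) + \<beta>)" for m
    by (simp add: lattice_count_Suc)
  \<comment> \<open>The coefficients come from summing the increments \<alpha> k + \<beta> for k
    from 1 to \<open>m\<close>, starting from \<open>lattice_count_0\<close>.\<close>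
  have "real (lattice_count m) = \<alpha> / 2 * (real m)\<^sup>2 + (\<alpha> / 2 + \<beta>) * real m + 1" for m
  proof (induction m)
    case 0
    then show ?case by (simp add: lattice_count_0)
  next
    case (Suc m)
    then show ?case
      by (simp add: count_Suc field_simps power2_eq_square)
  qed
  then show ?thesis by blast
qed

end

subsection \<open>Volume as the leading coefficient of the lattice point count\<close>

text \<open>Half-open cubes at lattice points tile space: each point lies in exactly one, the one at
  its coordinatewise floor.\<close>

definition unit_cube :: "real ^ 'n \<Rightarrow> (real ^ 'n) set" where
  "unit_cube x = {y. \<forall>i. x $ i \<le> y $ i \<and> y $ i < x $ i + 1}"

text \<open>The cube lies between an open and a closed box of the same volume 1.\<close>

lemma unit_cube_measurable [measurable]: "unit_cube x \<in> sets borel"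
  and measure_unit_cube: "measure lborel (unit_cube x) = 1"
  and emeasure_unit_cube: "emeasure lborel (unit_cube x) = 1"
proof -
  let ?u = "x + (\<chi> i. 1)"
  have box: "box x ?u \<subseteq> unit_cube x" and cbox: "unit_cube x \<subseteq> cbox x ?u"
    by (auto simp: unit_cube_def mem_box_cart less_imp_le)
  have "unit_cube x = (\<Inter>i. {y. x $ i \<le> y $ i} \<inter> {y. y $ i < x $ i + 1})"
    by (auto simp: unit_cube_def)
  also have "\<dots> \<in> sets borel"
    by (intro sets.finite_INT sets.Int borel_closed borel_open
        closed_halfspace_component_ge_cart open_halfspace_component_lt_cart) auto
  finally show meas: "unit_cube x \<in> sets borel" .
  have ne: "cbox x ?u \<noteq> {}" by (auto simp: interval_ne_empty_cart)
  have "emeasure lborel (cbox x ?u) = ennreal (measure lborel (cbox x ?u))"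
    using emeasure_lborel_cbox_finite[of x ?u] by (intro emeasure_eq_ennreal_measure) auto
  also have "measure lborel (cbox x ?u) = 1"
    by (subst content_cbox_cart[OF ne]) simp
  finally have 1: "emeasure lborel (cbox x ?u) = 1" by simp
  have "emeasure lborel (box x ?u) = emeasure lborel (cbox x ?u)"
    by (simp add: emeasure_lborel_box_eq emeasure_lborel_cbox_eq)
  then have "1 \<le> emeasure lborel (unit_cube x)"
    using emeasure_mono[OF box, of lborel] meas 1 by simp
  moreover have "emeasure lborel (unit_cube x) \<le> 1"
    using emeasure_mono[OF cbox, of lborel] 1 by simp
  ultimately show "emeasure lborel (unit_cube x) = 1" by (rule antisym[rotated])
  then show "measure lborel (unit_cube x) = 1" by (simp add: measure_def)
qed

lemma disjoint_family_unit_cube: "disjoint_family_on unit_cube integer_lattice"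
proof (clarsimp simp: disjoint_family_on_def)
  fix x x' :: "real ^ 'a"
  assume "x \<in> integer_lattice" "x' \<in> integer_lattice" and ne: "x \<noteq> x'"
  show "unit_cube x \<inter> unit_cube x' = {}"
  proof (rule ccontr)
    assume "unit_cube x \<inter> unit_cube x' \<noteq> {}"
    then obtain y where y: "y \<in> unit_cube x" "y \<in> unit_cube x'" by blast
    have "x $ i = x' $ i" for i
    proof -
      obtain j k where "x $ i = of_int j" "x' $ i = of_int k"
        using \<open>x \<in> _\<close> \<open>x' \<in> _\<close> by (force simp: integer_lattice_def elim: Ints_cases)
      moreover have "\<bar>x $ i - x' $ i\<bar> < 1"
        using y by (auto simp: unit_cube_def abs_less_iff) (smt (verit))+
      ultimately show ?thesis by simp
    qed
    with ne show False by (simp add: vec_eq_iff)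
  qed
qed

lemma norm_diff_unit_cube_le:
  fixes x y :: "real ^ 'n"
  assumes "y \<in> unit_cube x"
  shows "norm (y - x) \<le> real CARD('n)"
proof -
  have "norm (y - x) \<le> (\<Sum>i\<in>UNIV. \<bar>(y - x) $ i\<bar>)" by (rule norm_le_l1_cart)
  also have "\<dots> \<le> (\<Sum>i\<in>(UNIV :: 'n set). 1)"
  proof (rule sum_mono)
    fix i
    show "\<bar>(y - x) $ i\<bar> \<le> 1"
      using assms by (auto simp: unit_cube_def abs_le_iff dest!: spec[of _ i])
  qed
  finally show ?thesis by simp
qed

lemma measure_Union_unit_cube:
  fixes A :: "(real ^ 'n) set"
  assumes "finite A" "A \<subseteq> integer_lattice"
  shows "measure lborel (\<Union>x\<in>A. unit_cube x) = real (card A)"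
proof -
  have "measure lborel (\<Union>x\<in>A. unit_cube x) = (\<Sum>x\<in>A. measure lborel (unit_cube x))"
    using assms(1) disjoint_family_on_mono[OF assms(2) disjoint_family_unit_cube]
    by (intro measure_finite_Union) (auto simp: emeasure_unit_cube)
  then show ?thesis by (simp add: measure_unit_cube)
qed

lemma measure_dilate:
  fixes P :: "(real ^ 'n) set"
  assumes "compact P" "t \<ge> 0"
  shows "measure lborel ((\<lambda>x. t *\<^sub>R x) ` P) = t ^ CARD('n) * measure lborel P"
proof -
  have "compact ((\<lambda>x. t *\<^sub>R x) ` P)" by (rule compact_scaling[OF assms(1)])
  then have "measure lborel ((\<lambda>x. t *\<^sub>R x) ` P) = measure lebesgue ((\<lambda>x. t *\<^sub>R x + 0) ` P)"
    by (simp add: borel_compact)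
  also have "\<dots> = t ^ CARD('n) * measure lebesgue P"
    using assms(2) by (subst measure_lebesgue_affine) simp
  finally show ?thesis using assms(1) by (simp add: borel_compact)
qed

text \<open>Write \<open>x = t p\<close> and \<open>z = c (z / c)\<close>. Both \<open>p\<close> and
  \<open>z / c\<close> lie in \<open>P\<close>, so \<open>x + z\<close> is \<open>t + c\<close>
  times a convex combination of points of \<open>P\<close>.\<close>

lemma add_mem_dilate:
  fixes P :: "'a :: real_normed_vector set"
  assumes "convex P" "cball 0 r \<subseteq> P" "r > 0" "c > 0" "t \<ge> 0"
    and "x \<in> (\<lambda>x. t *\<^sub>R x) ` P" "norm z \<le> c * r"
  shows "x + z \<in> (\<lambda>x. (t + c) *\<^sub>R x) ` P"
proof -
  obtain p where p: "p \<in> P" "x = t *\<^sub>R p" using assms by blast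
  have "z /\<^sub>R c \<in> P"
    using assms by (intro subsetD[OF assms(2)]) (simp add: field_simps)
  then have "(t / (t + c)) *\<^sub>R p + (c / (t + c)) *\<^sub>R (z /\<^sub>R c) \<in> P" (is "?q \<in> P")
    using assms p by (intro convexD) (auto simp flip: add_divide_distrib)
  moreover have "x + z = (t + c) *\<^sub>R ?q"
    using assms by (simp add: p scaleR_add_right)
  ultimately show ?thesis by blast
qed

text \<open>The number of lattice points is the volume of the union of their cubes. With
  \<open>c * r\<close> bounding the distance from a cube's corner to its points, this union lies
  inside the dilate by \<open>t + c\<close> and covers the dilate by \<open>t - c\<close>.\<close>

lemma lattice_count_bounds:
  fixes P :: "(real ^ 'n) set"
  assumes P: "compact P" "convex P" and r: "cball 0 r \<subseteq> P" "r > 0"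
    and fin: "finite ((\<lambda>x. t *\<^sub>R x) ` P \<inter> integer_lattice)"
    and c: "c = real CARD('n) / r" and "t \<ge> c"
  shows "(t - c) ^ CARD('n) * measure lborel P
      \<le> real (card ((\<lambda>x. t *\<^sub>R x) ` P \<inter> integer_lattice))"
    and "real (card ((\<lambda>x. t *\<^sub>R x) ` P \<inter> integer_lattice))
      \<le> (t + c) ^ CARD('n) * measure lborel P"
proof -
  let ?A = "(\<lambda>x. t *\<^sub>R x) ` P \<inter> integer_lattice"
  let ?U = "\<Union>x\<in>?A. unit_cube x"
  have "c > 0" using r by (simp add: c)
  have cr: "c * r = real CARD('n)" using r by (simp add: c)
  have card: "measure lborel ?U = real (card ?A)"
    by (rule measure_Union_unit_cube[OF fin]) simp
  have U: "?U \<in> sets lborel" using fin by auto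
  have comp: "compact ((\<lambda>x. s *\<^sub>R x) ` P)" for s by (rule compact_scaling[OF P(1)])
  have fm: "(\<lambda>x. s *\<^sub>R x) ` P \<in> fmeasurable lborel" for s
    using comp by (rule fmeasurable_compact)
  have sub: "?U \<subseteq> (\<lambda>x. (t + c) *\<^sub>R x) ` P"
  proof
    fix y assume "y \<in> ?U"
    then obtain x where x: "x \<in> (\<lambda>x. t *\<^sub>R x) ` P" "y \<in> unit_cube x" by blast
    have "x + (y - x) \<in> (\<lambda>x. (t + c) *\<^sub>R x) ` P"
      using norm_diff_unit_cube_le[OF x(2)] \<open>c > 0\<close> \<open>t \<ge> c\<close> cr
      by (intro add_mem_dilate[OF P(2) r \<open>c > 0\<close> _ x(1)]) auto
    then show "y \<in> (\<lambda>x. (t + c) *\<^sub>R x) ` P" by simp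
  qed
  then have "measure lborel ?U \<le> measure lborel ((\<lambda>x. (t + c) *\<^sub>R x) ` P)"
    using U fm by (intro measure_mono_fmeasurable) auto
  then show "real (card ?A) \<le> (t + c) ^ CARD('n) * measure lborel P"
    using \<open>c > 0\<close> \<open>t \<ge> c\<close> by (simp add: card measure_dilate[OF P(1)])
  have "(\<lambda>x. (t - c) *\<^sub>R x) ` P \<subseteq> ?U"
  proof
    fix y assume y: "y \<in> (\<lambda>x. (t - c) *\<^sub>R x) ` P"
    \<comment> \<open>The corner of the cube containing \<open>y\<close>; moving from
      \<open>y\<close> to it costs at most \<open>c\<close> in the dilation factor.\<close>
    define x :: "real ^ 'n" where "x = (\<chi> i. of_int \<lfloor>y $ i\<rfloor>)"
    have "y \<in> unit_cube x" by (auto simp: unit_cube_def x_def)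
    have "y + (x - y) \<in> (\<lambda>x. (t - c + c) *\<^sub>R x) ` P"
      using norm_diff_unit_cube_le[OF \<open>y \<in> unit_cube x\<close>] \<open>c > 0\<close> \<open>t \<ge> c\<close> cr
      by (intro add_mem_dilate[OF P(2) r \<open>c > 0\<close> _ y]) (auto simp: norm_minus_commute)
    moreover have "x \<in> integer_lattice" by (simp add: integer_lattice_def x_def)
    ultimately show "y \<in> ?U" using \<open>y \<in> unit_cube x\<close> by auto
  qed
  moreover have "?U \<in> fmeasurable lborel"
    by (rule fmeasurableI2[OF fm sub U])
  ultimately have "measure lborel ((\<lambda>x. (t - c) *\<^sub>R x) ` P) \<le> measure lborel ?U"
    using fmeasurableD[OF fm] by (intro measure_mono_fmeasurable)
  then show "(t - c) ^ CARD('n) * measure lborel P \<le> real (card ?A)"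
    using \<open>t \<ge> c\<close> by (simp add: card measure_dilate[OF P(1)])
qed

lemma lattice_count_asymptotics:
  fixes P :: "(real ^ 'n) set"
  assumes P: "compact P" "convex P" "0 \<in> interior P"
    and fin: "\<And>m. finite ((\<lambda>x. real m *\<^sub>R x) ` P \<inter> integer_lattice)"
  shows "(\<lambda>m. real (card ((\<lambda>x. real m *\<^sub>R x) ` P \<inter> integer_lattice)) / real m ^ CARD('n))
    \<longlonglongrightarrow> measure lborel P"
proof -
  obtain r where r: "r > 0" "cball 0 r \<subseteq> P"
    using P(3) by (auto simp: mem_interior_cball)
  define c where "c = real CARD('n) / r"
  let ?V = "measure lborel P"
  have lim: "(\<lambda>m. (1 + s / real m) ^ CARD('n) * ?V) \<longlonglongrightarrow> ?V" for s
  proof -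
    have "(\<lambda>m. (1 + s / real m) ^ CARD('n) * ?V) \<longlonglongrightarrow> (1 + 0) ^ CARD('n) * ?V"
      by (intro tendsto_intros lim_const_over_n)
    then show ?thesis by simp
  qed
  \<comment> \<open>The condition \<open>m \<ge> c\<close> keeps the inner dilation factor
    \<open>m - c\<close> nonnegative.\<close>
  have ev: "\<forall>\<^sub>F m in sequentially. real m \<ge> c \<and> m > 0"
    using eventually_ge_at_top[of "nat \<lceil>c\<rceil>"] eventually_gt_at_top[of 0]
    by eventually_elim (auto simp: nat_ceiling_le_eq)
  have pow: "(1 + s / real m) ^ CARD('n) = (real m + s) ^ CARD('n) / real m ^ CARD('n)"
    if "m > 0" for s m
    using that by (simp add: field_simps flip: power_divide)
  show ?thesis
  proof (rule tendsto_sandwich[OF _ _ lim[of "-c"] lim[of c]])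
    show "\<forall>\<^sub>F m in sequentially. (1 + (- c) / real m) ^ CARD('n) * ?V
        \<le> real (card ((\<lambda>x. real m *\<^sub>R x) ` P \<inter> integer_lattice)) / real m ^ CARD('n)"
      using ev
    proof eventually_elim
      case (elim m)
      then show ?case
        using lattice_count_bounds(1)[OF P(1,2) r(2,1) fin c_def, of m] pow[of m "-c"]
        by (auto simp: divide_right_mono)
    qed
    show "\<forall>\<^sub>F m in sequentially. real (card ((\<lambda>x. real m *\<^sub>R x) ` P \<inter> integer_lattice))
        / real m ^ CARD('n) \<le> (1 + c / real m) ^ CARD('n) * ?V"
      using ev
    proof eventually_elim
      case (elim m)
      then show ?case
        using lattice_count_bounds(2)[OF P(1,2) r(2,1) fin c_def, of m] pow[of m c]
        by (auto simp: divide_right_mono)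
    qed
  qed
qed

subsection \<open>Quadratic Ehrhart polynomials\<close>

text \<open>Two candidates agree at all naturals, so their difference has infinitely many roots and
  vanishes.\<close>

lemma ehrhart_poly_eqI:
  fixes P :: "(real ^ 'n) set"
  assumes "degree L = CARD('n)"
    and "\<And>m. poly L (of_nat m) = of_nat (card ((\<lambda>x. real m *\<^sub>R x) ` P \<inter> integer_lattice))"
  shows "ehrhart_poly P = L"
  unfolding ehrhart_poly_def
proof (rule the_equality)
  fix M :: "complex poly"
  assume M: "degree M = CARD('n) \<and>
    (\<forall>m::nat. poly M (of_nat m) = of_nat (card ((\<lambda>x. real m *\<^sub>R x) ` P \<inter> integer_lattice)))"
  have "range of_nat \<subseteq> {z. poly (M - L) z = 0}"
    using M assms(2) by auto
  moreover have "infinite (range (of_nat :: nat \<Rightarrow> complex))"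
    by (simp add: finite_image_iff inj_of_nat)
  ultimately have "M - L = 0"
    using poly_roots_finite finite_subset by blast
  then show "M = L" by simp
qed (use assms in auto)

lemma fps_of_poly_Poly_eq_imp_eq:
  fixes xs ys :: "int list"
  assumes "length xs = length ys"
    and "(fps_of_poly (Poly (map of_int xs)) :: complex fps) = fps_of_poly (Poly (map of_int ys))"
  shows "xs = ys"
proof (rule nth_equalityI[OF assms(1)])
  fix i assume i: "i < length xs"
  have "coeff (Poly (map of_int xs) :: complex poly) i = coeff (Poly (map of_int ys)) i"
    using assms(2) by simp
  then have "(of_int (xs ! i) :: complex) = of_int (ys ! i)"
    using i assms(1) by (simp add: coeff_Poly_eq nth_default_nth)
  then show "xs ! i = ys ! i" by simp
qed

lemma one_minus_fps_X_mult_nth: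
  fixes F :: "'a :: comm_ring_1 fps"
  shows "((1 - fps_X) * F) $ n = (if n = 0 then F $ 0 else F $ n - F $ (n - 1))"
  by (simp add: left_diff_distrib)

text \<open>Multiplying by \<open>(1 - fps_X) ^ 3\<close> takes third backward differences of the
  values, with zeros before index 0. They vanish from index 3 on because the polynomial is
  quadratic; the first three come from its values 1, \<open>p\<close>, \<open>q\<close> at 0, 1,
  2.\<close>

lemma delta_vector_quadratic:
  fixes P :: "(real ^ 2) set" and p q :: int
  assumes L: "ehrhart_poly P = [:1, B, A:]" and p: "1 + B + A = of_int p"
    and q: "1 + 2 * B + 4 * A = of_int q"
  shows "delta_vector P = [1, p - 3, q - 3 * p + 3]"
proof -
  let ?F = "Abs_fps (\<lambda>m. poly (ehrhart_poly P) (of_nat m))"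
  let ?ds = "[1, p - 3, q - 3 * p + 3]"
  have "?F * (1 - fps_X) ^ 3 = (1 - fps_X) * ((1 - fps_X) * ((1 - fps_X) * ?F))"
    by (simp add: power3_eq_cube mult_ac)
  also have "\<dots> = fps_of_poly (Poly (map of_int ?ds))"
  proof (rule fps_ext)
    fix n
    consider "n = 0" | "n = 1" | "n = Suc (Suc 0)" | k where "n = Suc (Suc (Suc k))"
      by (metis One_nat_def not0_implies_Suc)
    then show "((1 - fps_X) * ((1 - fps_X) * ((1 - fps_X) * ?F))) $ n
        = (fps_of_poly (Poly (map of_int ?ds)) :: complex fps) $ n"
      using p[symmetric] q[symmetric]
      by cases (simp_all add: one_minus_fps_X_mult_nth L fps_numeral_nth algebra_simps)
  qed
  finally have F: "?F * (1 - fps_X) ^ 3 = fps_of_poly (Poly (map of_int ?ds))" .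
  \<comment> \<open>The constant term is 1, so dividing by this power exactly undoes the
    multiplication.\<close>
  have "is_unit ((1 - fps_X) ^ 3 :: complex fps)"
    by (intro iffD2[OF is_unit_power_iff]) (simp add: fps_is_unit_iff)
  then have eq: "?F = G / (1 - fps_X) ^ 3 \<longleftrightarrow> ?F * (1 - fps_X) ^ 3 = G" for G
    by (rule unit_eq_div2)
  show ?thesis
    unfolding delta_vector_def
  proof (rule the_equality)
    show "length ?ds = CARD(2) + 1 \<and>
        ?F = fps_of_poly (Poly (map of_int ?ds)) / (1 - fps_X) ^ (CARD(2) + 1)"
      using F by (simp add: eq)
  next
    fix ds
    assume "length ds = CARD(2) + 1 \<and>
        ?F = fps_of_poly (Poly (map of_int ds)) / (1 - fps_X) ^ (CARD(2) + 1)"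
    then have "length ds = length ?ds"
      and "?F * (1 - fps_X) ^ 3 = fps_of_poly (Poly (map of_int ds))"
      by (simp_all add: eq)
    then show "ds = ?ds"
      by (intro fps_of_poly_Poly_eq_imp_eq) (simp_all only: F)
  qed
qed

section \<open>Roots of the quadratic \<open>V z\<^sup>2 + V z + 1\<close>\<close>

context
  fixes V :: real and R :: "complex set"
  assumes V: "V > 0"
  defines "R \<equiv> {z. poly [:1, of_real V, of_real V:] z = 0}"
begin

lemma quadratic_root_iff: "z \<in> R \<longleftrightarrow> (z + 1 / 2)\<^sup>2 = of_real (1 / 4 - 1 / V)"
proof -
  have poly: "poly [:1, of_real V, of_real V:] z = of_real V * ((z + 1 / 2)\<^sup>2 - of_real (1 / 4 - 1 / V))"
    using V by (simp add: field_simps power2_eq_square)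
  show ?thesis
    unfolding R_def mem_Collect_eq poly using V by simp
qed

lemma quadratic_roots_eq:
  assumes "w\<^sup>2 = of_real (1 / 4 - 1 / V)"
  shows "R = {- 1 / 2 + w, - 1 / 2 - w}"
proof -
  have "z \<in> R \<longleftrightarrow> (z + 1 / 2)\<^sup>2 = w\<^sup>2" for z
    by (simp add: quadratic_root_iff assms)
  moreover have "z + 1 / 2 = y \<longleftrightarrow> z = - 1 / 2 + y" for y z :: complex
    by auto
  ultimately show ?thesis
    by (auto simp: power2_eq_iff)
qed

lemma quadratic_roots_le:
  assumes "V \<le> 4"
  shows "R = {- 1 / 2 + of_real (sqrt (1 / V - 1 / 4)) * \<i>, - 1 / 2 - of_real (sqrt (1 / V - 1 / 4)) * \<i>}"
proof (rule quadratic_roots_eq)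
  have "1 / V - 1 / 4 \<ge> 0" using V assms by (simp add: field_simps)
  then show "(of_real (sqrt (1 / V - 1 / 4)) * \<i>)\<^sup>2 = complex_of_real (1 / 4 - 1 / V)"
    by (simp add: power_mult_distrib flip: of_real_power)
qed

lemma quadratic_roots_ge:
  assumes "V \<ge> 4"
  shows "R = {- 1 / 2 + of_real (sqrt (1 / 4 - 1 / V)), - 1 / 2 - of_real (sqrt (1 / 4 - 1 / V))}"
proof (rule quadratic_roots_eq)
  have "1 / 4 - 1 / V \<ge> 0" using V assms by (simp add: field_simps)
  then show "(of_real (sqrt (1 / 4 - 1 / V)))\<^sup>2 = complex_of_real (1 / 4 - 1 / V)"
    by (simp flip: of_real_power)
qed

lemma quadratic_roots_Re_iff: "(\<forall>z\<in>R. Re z = - 1 / 2) \<longleftrightarrow> V \<le> 4"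
proof
  assume Re: "\<forall>z\<in>R. Re z = - 1 / 2"
  show "V \<le> 4"
  proof (rule ccontr)
    assume "\<not> V \<le> 4"
    \<comment> \<open>The strict inequality gives a nonzero square root, so the real roots differ
      from -1/2.\<close>
    then have "1 / 4 - 1 / V > 0" using V by (simp add: field_simps)
    then show False
      using Re quadratic_roots_ge \<open>\<not> V \<le> 4\<close> by simp
  qed
qed (simp add: quadratic_roots_le)

lemma quadratic_roots_Im_iff: "(\<forall>z\<in>R. Im z = 0) \<longleftrightarrow> V \<ge> 4"
proof
  assume Im: "\<forall>z\<in>R. Im z = 0"
  show "V \<ge> 4"
  proof (rule ccontr)
    assume "\<not> V \<ge> 4"
    \<comment> \<open>Likewise the imaginary parts are now nonzero.\<close>
    then have "1 / V - 1 / 4 > 0" using V by (simp add: field_simps)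
    then show False
      using Im quadratic_roots_le \<open>\<not> V \<ge> 4\<close> by simp
  qed
qed (simp add: quadratic_roots_ge)

lemma quadratic_roots_vertical_iff:
  "(\<exists>b::real. R = {- 1 / 2 + of_real b * \<i>, - 1 / 2 - of_real b * \<i>}) \<longleftrightarrow> V \<le> 4"
proof
  assume "\<exists>b::real. R = {- 1 / 2 + of_real b * \<i>, - 1 / 2 - of_real b * \<i>}"
  then show "V \<le> 4" unfolding quadratic_roots_Re_iff[symmetric] by auto
qed (use quadratic_roots_le in blast)

lemma quadratic_roots_real_iff:
  "(\<exists>a::real. R = {of_real a, - 1 - of_real a}) \<longleftrightarrow> V \<ge> 4"
proof
  assume "\<exists>a::real. R = {of_real a, - 1 - of_real a}"
  then show "V \<ge> 4" unfolding quadratic_roots_Im_iff[symmetric] by auto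
next
  assume "V \<ge> 4"
  \<comment> \<open>The two roots are symmetric about -1/2, so the second is -1 minus the
    first.\<close>
  then have "R = {of_real (- 1 / 2 + sqrt (1 / 4 - 1 / V)),
      - 1 - of_real (- 1 / 2 + sqrt (1 / 4 - 1 / V))}"
    by (simp add: quadratic_roots_ge)
  then show "\<exists>a::real. R = {of_real a, - 1 - of_real a}" by blast
qed

text \<open>A real root satisfies \<open>V * (a * (a + 1)) = -1\<close>, so \<open>a\<close> and
  \<open>a + 1\<close> have opposite signs.\<close>

lemma quadratic_real_root_bounds:
  assumes "of_real a \<in> R"
  shows "-1 < a" "a < 0"
proof -
  have "complex_of_real (1 + V * a + V * a\<^sup>2) = 0"
    using assms by (simp add: R_def algebra_simps power2_eq_square)
  then have *: "1 + V * a + V * a\<^sup>2 = 0"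
    by (simp only: of_real_eq_0_iff)
  then have "V * (a * (a + 1)) < 0" by (simp add: algebra_simps power2_eq_square)
  then have "a * (a + 1) < 0" using V by (simp add: mult_less_0_iff)
  then show "-1 < a" "a < 0" by (auto simp: mult_less_0_iff)
qed

end

section \<open>Ehrhart polynomial, volume and delta-vector of a reflexive polygon\<close>

context reflexive_polygon
begin

lemma volume_pos: "measure lborel P > 0"
proof -
  obtain r where "r > 0" "cball 0 r \<subseteq> P"
    using zero_in_interior by (auto simp: mem_interior_cball)
  then have "0 < measure lborel (cball (0 :: real ^ 2) r)"
    by (intro content_cball_pos)
  also have "\<dots> \<le> measure lborel P"
    using \<open>cball 0 r \<subseteq> P\<close> compact
    by (intro measure_mono_fmeasurable fmeasurable_compact) auto
  finally show ?thesis .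
qed

text \<open>Divided by \<open>m\<^sup>2\<close>, the count tends to its leading coefficient and also
  to the volume, so the two agree.\<close>

lemma lattice_count_volume:
  "\<exists>B. \<forall>m. real (lattice_count m) = measure lborel P * (real m)\<^sup>2 + B * real m + 1"
proof -
  obtain A B where count: "\<And>m. real (lattice_count m) = A * (real m)\<^sup>2 + B * real m + 1"
    using lattice_count_quadratic by blast
  have "(\<lambda>m. real (lattice_count m) / real m ^ CARD(2)) \<longlonglongrightarrow> measure lborel P"
    unfolding lattice_count_def
    by (rule lattice_count_asymptotics[OF compact convex zero_in_interior finite_dilate_lattice])
  moreover have "(\<lambda>m. real (lattice_count m) / real m ^ CARD(2)) \<longlonglongrightarrow> A"
  proof -
    have "(\<lambda>m. A + B * (1 / real m) + 1 / real m * (1 / real m)) \<longlonglongrightarrow> A + B * 0 + 0 * 0"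
      by (intro tendsto_intros lim_const_over_n)
    moreover have "\<forall>\<^sub>F m in sequentially.
        A + B * (1 / real m) + 1 / real m * (1 / real m) = real (lattice_count m) / real m ^ CARD(2)"
      using eventually_gt_at_top[of 0]
      by eventually_elim (simp add: count field_simps power2_eq_square)
    ultimately show ?thesis
      by (simp add: tendsto_cong)
  qed
  ultimately have "measure lborel P = A" by (rule LIMSEQ_unique)
  with count show ?thesis by auto
qed

text \<open>The entries of the delta-vector determine the counts at 1 and 2, which are two linear
  equations for the remaining coefficients \<open>B\<close> and \<open>V\<close>. The final entry 1
  is what makes them equal.\<close>

lemma ehrhart_data:
  fixes \<delta>\<^sub>1 :: int
  assumes "delta_vector P = [1, \<delta>\<^sub>1, 1]"
  defines "V \<equiv> measure lborel P"
  shows "ehrhart_poly P = [:1, of_real V, of_real V:]"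
    and "V = (of_int \<delta>\<^sub>1 + 2) / 2"
    and "int (card (P \<inter> integer_lattice)) = \<delta>\<^sub>1 + 3"
proof -
  obtain B where count: "\<And>m. real (lattice_count m) = V * (real m)\<^sup>2 + B * real m + 1"
    using lattice_count_volume unfolding V_def by blast
  have "V \<noteq> 0" using volume_pos by (simp add: V_def)
  have L: "ehrhart_poly P = [:1, of_real B, of_real V:]"
  proof (rule ehrhart_poly_eqI)
    show "degree [:1, complex_of_real B, complex_of_real V:] = CARD(2)"
      using \<open>V \<noteq> 0\<close> by simp
    fix m
    have "poly [:1, of_real B, of_real V:] (of_nat m)
        = complex_of_real (real (lattice_count m))"
      unfolding count by (simp add: algebra_simps power2_eq_square)
    then show "poly [:1, of_real B, of_real V:] (of_nat m)
        = complex_of_nat (card ((\<lambda>x. real m *\<^sub>R x) ` P \<inter> integer_lattice))"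
      by (simp add: lattice_count_def)
  qed
  have 1: "1 + B + V = real (lattice_count 1)" and 2: "1 + 2 * B + 4 * V = real (lattice_count 2)"
    by (simp_all add: count)
  have "delta_vector P = [1, int (lattice_count 1) - 3,
      int (lattice_count 2) - 3 * int (lattice_count 1) + 3]"
  proof (rule delta_vector_quadratic[OF L])
    show "1 + complex_of_real B + complex_of_real V = of_int (int (lattice_count 1))"
      using arg_cong[OF 1, of complex_of_real] by simp
    show "1 + 2 * complex_of_real B + 4 * complex_of_real V = of_int (int (lattice_count 2))"
      using arg_cong[OF 2, of complex_of_real] by simp
  qed
  \<comment> \<open>The last entry gives
    \<open>lattice_count 2 = 3 * lattice_count 1 - 2\<close>.\<close>
  then have c1: "int (lattice_count 1) = \<delta>\<^sub>1 + 3" and c2: "int (lattice_count 2) = 3 * \<delta>\<^sub>1 + 7"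
    using assms(1) by auto
  have "1 + B + V = of_int \<delta>\<^sub>1 + 3" "1 + 2 * B + 4 * V = 3 * of_int \<delta>\<^sub>1 + 7"
    using 1 2 arg_cong[OF c1, of real_of_int] arg_cong[OF c2, of real_of_int] by simp_all
  then have "B = V" and V: "V = (of_int \<delta>\<^sub>1 + 2) / 2" by simp_all
  then show "ehrhart_poly P = [:1, of_real V, of_real V:]" "V = (of_int \<delta>\<^sub>1 + 2) / 2"
    using L by simp_all
  show "int (card (P \<inter> integer_lattice)) = \<delta>\<^sub>1 + 3"
    using c1 by (simp add: lattice_count_def)
qed

end

theorem proposition2p1:
  fixes P :: "(real ^ 2) set" and \<delta>\<^sub>1 :: int
  assumes "reflexive_polytope P"
    and "delta_vector P = [1, \<delta>\<^sub>1, 1]"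
  shows
    "((\<exists>b::real. ehrhart_roots P = {- 1 / 2 + of_real b * \<i>, - 1 / 2 - of_real b * \<i>}) \<or>
      (\<exists>a::real. ehrhart_roots P = {of_real a, - 1 - of_real a})) \<and>
     ((\<exists>b::real. ehrhart_roots P = {- 1 / 2 + of_real b * \<i>, - 1 / 2 - of_real b * \<i>})
        \<longleftrightarrow> CL_polytope P) \<and>
     ((\<exists>a::real. ehrhart_roots P = {of_real a, - 1 - of_real a}) \<longleftrightarrow> real_polytope P) \<and>
     ((CL_polytope P \<longleftrightarrow> \<delta>\<^sub>1 \<le> 6) \<and>
      (CL_polytope P \<longleftrightarrow> measure lborel P \<le> 4) \<and>
      (CL_polytope P \<longleftrightarrow> card (P \<inter> integer_lattice) \<le> 9)) \<and>
     ((real_polytope P \<longleftrightarrow> \<delta>\<^sub>1 \<ge> 6) \<and>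
      (real_polytope P \<longleftrightarrow> measure lborel P \<ge> 4) \<and>
      (real_polytope P \<longleftrightarrow> card (P \<inter> integer_lattice) \<ge> 9)) \<and>
     (\<forall>a::real. ehrhart_roots P = {of_real a, - 1 - of_real a} \<longrightarrow>
        -1 < a \<and> a < 0 \<and> (\<forall>z\<in>ehrhart_roots P. -1 < Re z \<and> Re z < 0))"
proof -
  interpret reflexive_polygon P by unfold_locales (rule assms(1))
  define V where "V = measure lborel P"
  have "V > 0" using volume_pos by (simp add: V_def)
  note data = ehrhart_data[OF assms(2), folded V_def]
  have roots: "ehrhart_roots P = {z. poly [:1, of_real V, of_real V:] z = 0}"
    by (simp add: ehrhart_roots_def data(1))
  have lattice: "lattice_polytope P"
    using assms(1) by (simp add: reflexive_polytope_def)
  have CL: "CL_polytope P \<longleftrightarrow> V \<le> 4"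
    unfolding CL_polytope_def roots using lattice quadratic_roots_Re_iff[OF \<open>V > 0\<close>] by blast
  have real: "real_polytope P \<longleftrightarrow> V \<ge> 4"
    unfolding real_polytope_def roots using lattice quadratic_roots_Im_iff[OF \<open>V > 0\<close>] by blast
  have vertical: "(\<exists>b::real. ehrhart_roots P =
      {- 1 / 2 + of_real b * \<i>, - 1 / 2 - of_real b * \<i>}) \<longleftrightarrow> V \<le> 4"
    unfolding roots by (rule quadratic_roots_vertical_iff[OF \<open>V > 0\<close>])
  have horizontal: "(\<exists>a::real. ehrhart_roots P = {of_real a, - 1 - of_real a}) \<longleftrightarrow> V \<ge> 4"
    unfolding roots by (rule quadratic_roots_real_iff[OF \<open>V > 0\<close>])
  \<comment> \<open>The bounds for \<open>a\<close> carry over to the other root, its reflection in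
    -1/2.\<close>
  have strip: "-1 < a \<and> a < 0 \<and> (\<forall>z\<in>ehrhart_roots P. -1 < Re z \<and> Re z < 0)"
    if a: "ehrhart_roots P = {of_real a, - 1 - of_real a}" for a
    using quadratic_real_root_bounds[OF \<open>V > 0\<close>, of a] unfolding roots[symmetric] a by auto
  \<comment> \<open>The thresholds 4, 6 and 9 match because the volume is
    \<open>(\<delta>\<^sub>1 + 2) / 2\<close> and the lattice point count is
    \<open>\<delta>\<^sub>1 + 3\<close>.\<close>
  have "V \<le> 4 \<longleftrightarrow> \<delta>\<^sub>1 \<le> 6" "V \<ge> 4 \<longleftrightarrow> \<delta>\<^sub>1 \<ge> 6"
    by (simp_all add: data(2) field_simps)
  moreover have "card (P \<inter> integer_lattice) \<le> 9 \<longleftrightarrow> \<delta>\<^sub>1 \<le> 6"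
    "card (P \<inter> integer_lattice) \<ge> 9 \<longleftrightarrow> \<delta>\<^sub>1 \<ge> 6"
    using data(3) by linarith+
  ultimately show ?thesis
    unfolding CL real vertical horizontal V_def[symmetric]
    using strip linear[of V 4] by blast
qed

end
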